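(* The function $f:[0,1]\to\mathbb{R}$ (extended by $f(0)=0$) is continuous at every point of the interval $(0,1)$, right-continuous at the point $x=0$, and left-continuous at the point $x=1$.
   Context: Let $\mathbb{Z}_0=\{0,1,2,\dots\}$. Every $x\in(0,1]$ has a unique $E$-representation, i.e. there is a unique sequence $(g_n(x))_{n\ge 1}$ of elements of $\mathbb{Z}_0$ with $x=\sum_{n=1}^\infty \frac{1}{(2+g_1)(2+g_1+g_2)\cdots(2+g_1+\dots+g_n)}$, where $g_n=g_n(x)$; this is written $x=\Delta^E_{g_1g_2\ldots g_n\ldots}$. Conversely, every sequence in $\mathbb{Z}_0$ is the $E$-representation of some $x\in(0,1]$. Standing assumptions: $(u_n)_{n\ge0}$ is a sequence of real numbers such that $\sum_{n=0}^\infty u_n$ converges with sum $1$, $|u_n|<1$ for all $n\ge 0$, and $r_n:=\sum_{i=n+1}^\infty u_i=1-(u_0+\dots+u_n)$ satisfies $0<r_n<1$ for all $n\ge0$. The function $f$ is defined on $(0,1]$ by $f(x)=r_{g_1(x)}+\sum_{k=2}^\infty\bigl(r_{g_k(x)}\prod_{i=1}^{k-1}u_{g_i(x)}\bigr)$ (the series converges absolutely), and $f(0):=0$. *)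

theory Defs
  imports Complex_Main
begin

text \<open>
  Digit sequences are indexed from 0 here: the digit traditionally written
  \<open>g\<^sub>n\<close> with \<open>n \<ge> 1\<close> is \<open>g (n - 1)\<close>.
\<close>

definition is_E_representation :: "(nat \<Rightarrow> nat) \<Rightarrow> real \<Rightarrow> bool" where
  "is_E_representation g x \<longleftrightarrow>
     (\<lambda>n. 1 / (\<Prod>k\<le>n. 2 + (\<Sum>i\<le>k. real (g i)))) sums x"

text \<open>
  Meaningful for \<open>0 < x \<le> 1\<close>, where the E-representation exists and is unique.
\<close>

definition E_digits :: "real \<Rightarrow> nat \<Rightarrow> nat" where
  "E_digits x = (THE g. is_E_representation g x)"

definition tail_sum :: "(nat \<Rightarrow> real) \<Rightarrow> nat \<Rightarrow> real" where
  "tail_sum u n = (\<Sum>i. u (i + Suc n))"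

text \<open>
  The summation index \<open>j\<close> below corresponds to \<open>k = j + 2\<close> in
  \<open>r\<^bsub>g\<^sub>1\<^esub> + (\<Sum>k\<ge>2. r\<^bsub>g\<^sub>k\<^esub> * u\<^bsub>g\<^sub>1\<^esub> * \<dots> * u\<^bsub>g\<^sub>k\<^sub>-\<^sub>1\<^esub>)\<close>.
  Only the values on \<open>[0, 1]\<close> are of interest.
\<close>

definition E_function :: "(nat \<Rightarrow> real) \<Rightarrow> real \<Rightarrow> real" where
  "E_function u x =
     (if x = 0 then 0
      else tail_sum u (E_digits x 0) +
           (\<Sum>j. tail_sum u (E_digits x (Suc j)) * (\<Prod>i\<le>j. u (E_digits x i))))"

end

theory Submission
  imports Defs
begin

text \<open>
  The E-representation is an Engel expansion: with \<open>q\<^sub>n = 2 + g\<^sub>1 + \<dots> + g\<^sub>n\<close> the remainder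
  \<open>z \<in> (1/q, 1/(q-1)]\<close> is mapped to \<open>q z - 1 \<in> (0, 1/(q-1)]\<close>. Allowing an arbitrary initial
  offset \<open>m\<close> instead of \<open>2\<close> gives a family \<open>\<phi>\<^sub>m\<close> on \<open>[0, 1/(m-1)]\<close> with \<open>f = \<phi>\<^sub>2\<close> and
  \<open>\<phi>\<^sub>m(z) = r\<^bsub>q-m\<^esub> + u\<^bsub>q-m\<^esub> \<phi>\<^sub>q(q z - 1)\<close>. Since \<open>\<phi>\<^sub>q(1/(q-1)) = 1\<close> and \<open>r\<^bsub>n+1\<^esub> + u\<^bsub>n+1\<^esub> = r\<^sub>n\<close>, this
  equation holds on the closed interval \<open>[1/q, 1/(q-1)]\<close>. Hence each one-sided oscillation of
  \<open>\<phi>\<^sub>m\<close> at \<open>z > 0\<close> is at most \<open>c = sup |u\<^sub>n| < 1\<close> times one of \<open>\<phi>\<^sub>q\<close> at \<open>q z - 1\<close>, while at \<open>0\<close>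
  continuity is immediate because small \<open>z\<close> have a large first digit.
\<close>

section \<open>Engel expansions with an arbitrary offset\<close>

definition engel_term :: "nat \<Rightarrow> (nat \<Rightarrow> nat) \<Rightarrow> nat \<Rightarrow> real" where
  "engel_term m g n = 1 / (\<Prod>k\<le>n. real m + (\<Sum>i\<le>k. real (g i)))"

text \<open>For \<open>0 < z \<le> 1\<close> this is the unique \<open>q\<close> with
  \<open>1 / q < z \<le> 1 / (q - 1)\<close>: the pieces are closed on the right only.\<close>

definition engel_denom :: "real \<Rightarrow> nat" where
  "engel_denom z = nat \<lfloor>1 / z\<rfloor> + 1"

text \<open>The greedy expansion. The natural-number subtraction does not truncate for
  \<open>0 < z \<le> 1 / (m - 1)\<close> and \<open>m \<ge> 2\<close>, by
  \<open>engel_denom_bounds\<close>.\<close>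

fun engel_digits :: "nat \<Rightarrow> real \<Rightarrow> nat \<Rightarrow> nat" where
  "engel_digits m z 0 = engel_denom z - m"
| "engel_digits m z (Suc n) =
     engel_digits (engel_denom z) (real (engel_denom z) * z - 1) n"

lemma engel_term_0: "engel_term m g 0 = 1 / real (m + g 0)"
  by (simp add: engel_term_def)

text \<open>A dropped first digit is absorbed by the offset; this self-similarity is the reason for
  a variable \<open>m\<close>.\<close>

lemma engel_term_Suc:
  "engel_term m g (Suc n) = engel_term (m + g 0) (\<lambda>i. g (Suc i)) n / real (m + g 0)"
  unfolding engel_term_def prod.atMost_Suc_shift
  by (simp add: sum.atMost_Suc_shift add.assoc mult.commute del: sum.atMost_Suc)

lemma engel_term_pos:
  assumes "m > 0"
  shows "engel_term m g n > 0"
  unfolding engel_term_def using assms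
  by (auto intro!: prod_pos divide_pos_pos add_pos_nonneg sum_nonneg)

lemma engel_term_le:
  assumes "m > 0"
  shows "engel_term m g n \<le> (1 / real (m + g 0)) ^ Suc n"
proof -
  have "real (m + g 0) ^ Suc n \<le> (\<Prod>k\<le>n. real m + (\<Sum>i\<le>k. real (g i)))"
  proof -
    have "real (g 0) \<le> (\<Sum>i\<le>k. real (g i))" for k
      by (rule member_le_sum) auto
    then have "(\<Prod>k\<le>n. real (m + g 0)) \<le> (\<Prod>k\<le>n. real m + (\<Sum>i\<le>k. real (g i)))"
      by (intro prod_mono) auto
    then show ?thesis by simp
  qed
  moreover have "0 < real (m + g 0) ^ Suc n"
    using assms by simp
  ultimately show ?thesis
    unfolding engel_term_def power_one_over by (intro divide_left_mono mult_pos_pos) auto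
qed

lemma engel_denom_eq:
  assumes "q \<ge> 2" "1 / real q < z" "z \<le> 1 / (real q - 1)"
  shows "engel_denom z = q"
proof -
  have "z > 0" using assms(2) by (rule le_less_trans[rotated]) simp
  then have "\<lfloor>1 / z\<rfloor> = int q - 1"
    using assms by (intro floor_unique) (auto simp: field_simps)
  then show ?thesis using assms(1) by (simp add: engel_denom_def)
qed

text \<open>The remainder satisfies \<open>q * z - 1 \<le> z\<close> because
  \<open>(q - 1) * z \<le> 1\<close>, so it lies in the domain for offset \<open>q\<close> and the
  greedy step can be repeated.\<close>

lemma engel_denom_bounds:
  assumes "m \<ge> 2" "0 < z" "z \<le> 1 / (real m - 1)"
  defines "q \<equiv> engel_denom z"
  shows "m \<le> q" "1 / real q < z" "z \<le> 1 / (real q - 1)"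
    "0 < real q * z - 1" "real q * z - 1 \<le> 1 / (real q - 1)"
proof -
  have m: "real m - 1 \<le> 1 / z"
    using assms by (simp add: field_simps)
  then have "int m - 1 \<le> \<lfloor>1 / z\<rfloor>"
    by (simp add: le_floor_iff)
  then have q: "int q = \<lfloor>1 / z\<rfloor> + 1" and mq: "m \<le> q"
    using assms(1,2) by (auto simp: q_def engel_denom_def)
  have "real q = real_of_int \<lfloor>1 / z\<rfloor> + 1"
    using q by (metis of_int_1 of_int_add of_int_of_nat_eq)
  then have b: "1 / z < real q" "real q - 1 \<le> 1 / z"
    by linarith+
  show "m \<le> q" by (rule mq)
  have q2: "real q \<ge> 2" using mq assms(1) by simp
  show "1 / real q < z" and up: "z \<le> 1 / (real q - 1)" and "0 < real q * z - 1"
    using b q2 assms(2) by (auto simp: field_simps)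
  have "real q * z - 1 \<le> z"
    using b(2) assms(2) by (simp add: field_simps)
  with up show "real q * z - 1 \<le> 1 / (real q - 1)" by simp
qed

section \<open>Uniqueness of the digits\<close>

lemma engel_sums_shift:
  assumes "m > 0" "engel_term m g sums z"
  shows "engel_term (m + g 0) (\<lambda>i. g (Suc i)) sums (real (m + g 0) * z - 1)"
proof -
  have "(\<lambda>n. engel_term m g (Suc n)) sums (z - engel_term m g 0)"
    using assms(2) by (simp add: sums_Suc_iff)
  from sums_mult[OF this, of "real (m + g 0)"] show ?thesis
    using assms(1) by (simp add: engel_term_Suc engel_term_0 right_diff_distrib del: of_nat_add)
qed

lemma engel_sums_pos:
  assumes "m > 0" "engel_term m g sums z"
  shows "z > 0"
  using assms engel_term_pos[OF assms(1)] suminf_pos[of "engel_term m g"] sums_iff by metis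

text \<open>All factors of the denominators are at least \<open>m + g 0\<close>, so a geometric
  series dominates; its sum is the stated bound.\<close>

lemma engel_sums_le:
  assumes "m \<ge> 2" "engel_term m g sums z"
  shows "z \<le> 1 / (real (m + g 0) - 1)"
proof -
  define q where "q = real (m + g 0)"
  have q: "q \<ge> 2" using assms(1) by (simp add: q_def)
  then have "(\<lambda>n. (1 / q) ^ n) sums (1 / (1 - 1 / q))"
    by (intro geometric_sums) simp
  from sums_mult[OF this, of "1 / q"]
  have "(\<lambda>n. (1 / q) ^ Suc n) sums (1 / (q - 1))"
    using q by (simp add: field_simps)
  with assms(2) show ?thesis
    unfolding q_def[symmetric]
    by (rule sums_le[rotated]) (use engel_term_le assms(1) q_def in auto)
qed

text \<open>The sum determines the first digit: positivity of the shifted sum gives the strict lower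
  bound, the geometric majorant the upper one.\<close>

lemma engel_sums_denom:
  assumes "m \<ge> 2" "engel_term m g sums z"
  shows "engel_denom z = m + g 0"
proof (rule engel_denom_eq)
  have "real (m + g 0) * z - 1 > 0"
    using assms by (intro engel_sums_pos[OF _ engel_sums_shift]) auto
  then show "1 / real (m + g 0) < z"
    using assms(1) by (simp add: field_simps)
  show "z \<le> 1 / (real (m + g 0) - 1)"
    using assms by (rule engel_sums_le)
qed (use assms in auto)

lemma engel_sums_unique:
  assumes "m \<ge> 2" "engel_term m g sums z"
  shows "g n = engel_digits m z n"
  using assms
proof (induction n arbitrary: m g z)
  case 0
  then show ?case by (simp add: engel_sums_denom)
next
  case (Suc n)
  have "g (Suc n) = engel_digits (m + g 0) (real (m + g 0) * z - 1) n"
    using Suc.prems by (intro Suc.IH engel_sums_shift) auto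
  then show ?case using engel_sums_denom[OF Suc.prems] by simp
qed

text \<open>Passing to the remainder divides the error by \<open>q \<ge> 2\<close>; initially it is
  \<open>z \<le> 1\<close>.\<close>

lemma engel_partial_sum:
  assumes "m \<ge> 2" "0 < z" "z \<le> 1 / (real m - 1)"
  shows "\<bar>z - (\<Sum>i<n. engel_term m (engel_digits m z) i)\<bar> \<le> (1 / 2) ^ n"
  using assms
proof (induction n arbitrary: m z)
  case 0
  have "1 / (real m - 1) \<le> 1" using 0(1) by simp
  with 0(3) have "z \<le> 1" by (rule order_trans)
  with 0(2) show ?case by simp
next
  case (Suc n)
  define q where "q = engel_denom z"
  define w where "w = real q * z - 1"
  note b = engel_denom_bounds[OF Suc.prems, folded q_def, folded w_def]
  have q2: "q \<ge> 2" using b(1) Suc.prems(1) by simp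
  have mq: "m + engel_digits m z 0 = q" using b(1) by (simp add: q_def)
  have "(\<Sum>i<Suc n. engel_term m (engel_digits m z) i) =
      1 / real q + (\<Sum>i<n. engel_term q (engel_digits q w) i) / real q"
    unfolding sum.lessThan_Suc_shift engel_term_0 engel_term_Suc mq
    by (simp add: q_def w_def sum_divide_distrib)
  then have "z - (\<Sum>i<Suc n. engel_term m (engel_digits m z) i) =
      (w - (\<Sum>i<n. engel_term q (engel_digits q w) i)) / real q"
    using q2 by (simp add: w_def field_simps)
  moreover have "\<bar>w - (\<Sum>i<n. engel_term q (engel_digits q w) i)\<bar> / real q \<le> (1 / 2) ^ n / 2"
    using Suc.IH[OF q2 b(4,5)] q2 by (intro frac_le) auto
  ultimately show ?case by simp
qed

lemma engel_digits_sums: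
  assumes "m \<ge> 2" "0 < z" "z \<le> 1 / (real m - 1)"
  shows "engel_term m (engel_digits m z) sums z"
proof -
  have "(\<lambda>n. z - (\<Sum>i<n. engel_term m (engel_digits m z) i)) \<longlonglongrightarrow> 0"
    by (rule tendsto_rabs_zero_cancel, rule tendsto_sandwich[OF _ _ tendsto_const
          LIMSEQ_power_zero[of "1 / 2 :: real"]])
      (use engel_partial_sum[OF assms] in auto)
  from tendsto_diff[OF tendsto_const[of z] this] show ?thesis
    by (simp add: sums_def)
qed

lemma E_digits_eq:
  assumes "0 < x" "x \<le> 1"
  shows "E_digits x = engel_digits 2 x"
  unfolding E_digits_def
proof (rule the_equality)
  have rep: "is_E_representation g x \<longleftrightarrow> engel_term 2 g sums x" for g
    by (simp add: is_E_representation_def engel_term_def[abs_def])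
  show "is_E_representation (engel_digits 2 x) x"
    unfolding rep using assms by (intro engel_digits_sums) auto
  show "g = engel_digits 2 x" if "is_E_representation g x" for g
    using that engel_sums_unique[of 2 g x] unfolding rep by auto
qed


section \<open>The function on digit sequences\<close>

definition digit_value :: "(nat \<Rightarrow> real) \<Rightarrow> (nat \<Rightarrow> nat) \<Rightarrow> real" where
  "digit_value u g =
     tail_sum u (g 0) + (\<Sum>j. tail_sum u (g (Suc j)) * (\<Prod>i\<le>j. u (g i)))"

definition engel_function :: "(nat \<Rightarrow> real) \<Rightarrow> nat \<Rightarrow> real \<Rightarrow> real" where
  "engel_function u m z = (if z = 0 then 0 else digit_value u (engel_digits m z))"

lemma E_function_eq:
  assumes "0 \<le> x" "x \<le> 1"
  shows "E_function u x = engel_function u 2 x"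
  using assms by (simp add: E_function_def engel_function_def digit_value_def E_digits_eq)

lemma tail_sum_eq:
  assumes "u sums 1"
  shows "tail_sum u n = 1 - (\<Sum>i\<le>n. u i)"
  using suminf_minus_initial_segment[OF sums_summable[OF assms], of "Suc n"] sums_unique[OF assms]
  by (simp add: tail_sum_def lessThan_Suc_atMost)

lemma tail_sum_tendsto_0:
  assumes "u sums 1"
  shows "tail_sum u \<longlonglongrightarrow> 0"
proof -
  have "(\<lambda>n. \<Sum>i\<le>n. u i) \<longlonglongrightarrow> 1"
    using assms by (simp add: sums_def_le)
  from tendsto_diff[OF tendsto_const[of 1] this] show ?thesis
    by (simp add: tail_sum_eq[OF assms, abs_def])
qed

text \<open>Only finitely many terms reach \<open>1 / 2\<close> in absolute value, and finitely many
  numbers below 1 have a maximum below 1.\<close>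

lemma null_sequence_uniform_bound:
  fixes u :: "nat \<Rightarrow> real"
  assumes "u \<longlonglongrightarrow> 0" "\<And>n. \<bar>u n\<bar> < 1"
  shows "\<exists>c. 0 < c \<and> c < 1 \<and> (\<forall>n. \<bar>u n\<bar> \<le> c)"
proof -
  obtain N where N: "\<And>n. n \<ge> N \<Longrightarrow> \<bar>u n\<bar> < 1 / 2"
    using LIMSEQ_D[OF assms(1), of "1 / 2"] by auto
  define S where "S = insert (1 / 2) ((\<lambda>n. \<bar>u n\<bar>) ` {..<N})"
  have S: "finite S" "S \<noteq> {}" by (auto simp: S_def)
  have "\<bar>u n\<bar> \<le> Max S" for n
  proof (cases "n < N")
    case True
    then show ?thesis using S by (intro Max_ge) (auto simp: S_def)
  next
    case False
    have "1 / 2 \<le> Max S" using S by (intro Max_ge) (auto simp: S_def)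
    with N[of n] False show ?thesis by simp
  qed
  moreover have "Max S < 1"
    using S assms(2) by (subst Max_less_iff) (auto simp: S_def)
  moreover have "0 < Max S"
    using S by (subst Max_gr_iff) (auto simp: S_def)
  ultimately show ?thesis by blast
qed

locale E_weights =
  fixes u :: "nat \<Rightarrow> real" and c :: real
  assumes sums_1: "u sums 1"
    and tail_sum_bounds: "\<And>n. 0 < tail_sum u n \<and> tail_sum u n < 1"
    and c: "0 < c" "c < 1"
    and u_le: "\<And>n. \<bar>u n\<bar> \<le> c"
begin

abbreviation "r \<equiv> tail_sum u"

abbreviation "\<phi> \<equiv> engel_function u"

lemma tail_sum_Suc: "r (Suc n) + u (Suc n) = r n"
  by (simp add: tail_sum_eq[OF sums_1])

lemma tail_sum_0: "r 0 = 1 - u 0"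
  by (simp add: tail_sum_eq[OF sums_1])

lemma digit_value_term_le: "\<bar>r (g (Suc j)) * (\<Prod>i\<le>j. u (g i))\<bar> \<le> c ^ Suc j"
proof -
  have "(\<Prod>i\<le>j. \<bar>u (g i)\<bar>) \<le> (\<Prod>i\<le>j. c)"
    using u_le by (intro prod_mono) auto
  moreover have "\<bar>r (g (Suc j))\<bar> \<le> 1"
    using tail_sum_bounds[of "g (Suc j)"] by simp
  ultimately have "\<bar>r (g (Suc j))\<bar> * (\<Prod>i\<le>j. \<bar>u (g i)\<bar>) \<le> 1 * (\<Prod>i\<le>j. c)"
    by (intro mult_mono) (auto intro: prod_nonneg)
  then show ?thesis by (simp add: abs_mult abs_prod)
qed

lemma summable_digit_value:
  "summable (\<lambda>j. \<bar>r (g (Suc j)) * (\<Prod>i\<le>j. u (g i))\<bar>)"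
proof (rule summable_comparison_test')
  show "summable (\<lambda>j. c ^ Suc j)"
    using c by (simp add: summable_mult)
  show "norm \<bar>r (g (Suc j)) * (\<Prod>i\<le>j. u (g i))\<bar> \<le> c ^ Suc j" if "j \<ge> 0" for j
    using digit_value_term_le by simp
qed

text \<open>The geometric majorant gives a bound independent of the digits, hence of offset and
  argument.\<close>

lemma abs_digit_value_le: "\<bar>digit_value u g\<bar> \<le> 1 / (1 - c)"
proof -
  have c': "(\<lambda>j. c ^ Suc j) sums (c / (1 - c))"
    using sums_mult[OF geometric_sums[of c], of c] c by simp
  have "\<bar>\<Sum>j. r (g (Suc j)) * (\<Prod>i\<le>j. u (g i))\<bar> \<le>
      (\<Sum>j. \<bar>r (g (Suc j)) * (\<Prod>i\<le>j. u (g i))\<bar>)"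
    by (rule summable_rabs[OF summable_digit_value])
  also have "\<dots> \<le> c / (1 - c)"
    unfolding sums_unique[OF c']
    by (rule suminf_le[OF digit_value_term_le summable_digit_value sums_summable[OF c']])
  finally have "\<bar>digit_value u g\<bar> \<le> 1 + c / (1 - c)"
    using tail_sum_bounds[of "g 0"] unfolding digit_value_def by linarith
  also have "\<dots> = 1 / (1 - c)"
    using c by (simp add: field_simps)
  finally show ?thesis .
qed

lemma digit_value_Cons:
  "digit_value u g = r (g 0) + u (g 0) * digit_value u (\<lambda>i. g (Suc i))"
proof -
  let ?f = "\<lambda>j. r (g (Suc j)) * (\<Prod>i\<le>j. u (g i))"
  let ?f' = "\<lambda>j. r (g (Suc (Suc j))) * (\<Prod>i\<le>j. u (g (Suc i)))"
  have "summable ?f"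
    by (rule summable_rabs_cancel[OF summable_digit_value])
  then have "suminf ?f = ?f 0 + (\<Sum>j. ?f (Suc j))"
    by (subst suminf_split_head) auto
  also have "(\<lambda>j. ?f (Suc j)) = (\<lambda>j. u (g 0) * ?f' j)"
    unfolding prod.atMost_Suc_shift by (simp add: mult_ac)
  also have "suminf \<dots> = u (g 0) * suminf ?f'"
    by (rule suminf_mult, rule summable_rabs_cancel[OF summable_digit_value])
  finally show ?thesis
    by (simp add: digit_value_def algebra_simps)
qed

section \<open>The functional equation of the family \<open>\<phi> m\<close>\<close>

lemma abs_engel_function_le: "\<bar>\<phi> m z\<bar> \<le> 1 / (1 - c)"
  using abs_digit_value_le c by (auto simp: engel_function_def)

lemma engel_function_step:
  assumes "m \<ge> 2" "0 < z" "z \<le> 1 / (real m - 1)"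
  defines "q \<equiv> engel_denom z"
  shows "\<phi> m z = r (q - m) + u (q - m) * \<phi> q (real q * z - 1)"
proof -
  have "real q * z - 1 \<noteq> 0"
    using engel_denom_bounds(4)[OF assms(1-3)] by (simp add: q_def)
  then show ?thesis
    using assms(2) by (subst engel_function_def, subst digit_value_Cons)
      (simp add: q_def engel_function_def)
qed

text \<open>This point is fixed by the remainder map, so its value solves
  \<open>v = r 0 + u 0 * v\<close> with \<open>r 0 = 1 - u 0\<close>.\<close>

lemma engel_function_right_end:
  assumes "m \<ge> 2"
  shows "\<phi> m (1 / (real m - 1)) = 1"
proof -
  let ?v = "\<phi> m (1 / (real m - 1))"
  have "engel_denom (1 / (real m - 1)) = m"
    using assms by (intro engel_denom_eq) (auto simp: field_simps)
  moreover have "real m * (1 / (real m - 1)) - 1 = 1 / (real m - 1)"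
    using assms by (simp add: field_simps)
  ultimately have "?v = r 0 + u 0 * ?v"
    using engel_function_step[of m "1 / (real m - 1)"] assms by simp
  then have "(1 - u 0) * (?v - 1) = 0"
    by (simp add: tail_sum_0 algebra_simps)
  moreover have "u 0 \<noteq> 1" using u_le[of 0] c by auto
  ultimately show ?thesis by simp
qed

text \<open>The gain over \<open>engel_function_step\<close> is the left end \<open>1 / q\<close>.
  It belongs to the piece of \<open>q + 1\<close> and is mapped to the right end there, so adjacent
  formulas agree by \<open>tail_sum_Suc\<close>.\<close>

lemma engel_function_on_piece:
  assumes "m \<ge> 2" "m \<le> q" "1 / real q \<le> z" "z \<le> 1 / (real q - 1)"
  shows "\<phi> m z = r (q - m) + u (q - m) * \<phi> q (real q * z - 1)"
proof -
  have q: "real q \<ge> 2" using assms(1,2) by simp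
  have "0 < 1 / real q" using q by simp
  then have z0: "0 < z" using assms(3) by (rule less_le_trans)
  have "1 / (real q - 1) \<le> 1 / (real m - 1)"
    using assms(1,2) by (intro divide_left_mono) auto
  with assms(4) have zm: "z \<le> 1 / (real m - 1)" by simp
  show ?thesis
  proof (cases "z = 1 / real q")
    case False
    with assms(3) have "1 / real q < z" by simp
    with assms(4) have "engel_denom z = q"
      using q by (intro engel_denom_eq) simp_all
    then show ?thesis using engel_function_step[OF assms(1) z0 zm] by simp
  next
    case True
    have "engel_denom z = Suc q"
      using q True z0 by (intro engel_denom_eq) (auto simp: field_simps)
    moreover have "real (Suc q) * z - 1 = 1 / (real (Suc q) - 1)"
      using q True by (simp add: field_simps)
    ultimately have "\<phi> m z = r (Suc q - m) + u (Suc q - m) * 1"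
      using engel_function_step[OF assms(1) z0 zm] engel_function_right_end[of "Suc q"] q by simp
    also have "\<dots> = r (q - m)"
      using tail_sum_Suc[of "q - m"] assms(2) by (simp add: Suc_diff_le)
    \<comment> \<open>The remainder for \<open>q\<close> is 0 here, and the convention
      \<open>\<phi> q 0 = 0\<close> removes the \<open>u\<close> term.\<close>
    finally show ?thesis using q True by (simp add: engel_function_def)
  qed
qed

text \<open>For small \<open>w\<close> the index \<open>q - m\<close> is large, so both weights in
  the functional equation are small, while \<open>\<phi> q\<close> is bounded uniformly in
  \<open>q\<close>.\<close>

lemma engel_function_near_0:
  assumes "m \<ge> 2" "\<epsilon> > 0"
  shows "\<exists>\<delta>>0. \<forall>w. 0 < w \<and> w < \<delta> \<longrightarrow> \<bar>\<phi> m w\<bar> \<le> \<epsilon>"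
proof -
  let ?M = "1 / (1 - c)"
  have "(\<lambda>n. \<bar>r n\<bar> + \<bar>u n\<bar> * ?M) \<longlonglongrightarrow> 0"
    using tail_sum_tendsto_0[OF sums_1] summable_LIMSEQ_zero[OF sums_summable[OF sums_1]] c
    by (auto intro!: tendsto_eq_intros)
  from LIMSEQ_D[OF this assms(2)] obtain N
    where N: "\<And>n. n \<ge> N \<Longrightarrow> \<bar>\<bar>r n\<bar> + \<bar>u n\<bar> * ?M\<bar> < \<epsilon>" by auto
  \<comment> \<open>This radius forces \<open>q > N + m\<close> and keeps \<open>w\<close> in the
    domain for offset \<open>m\<close>.\<close>
  have "\<bar>\<phi> m w\<bar> \<le> \<epsilon>" if w: "0 < w" "w < 1 / real (N + m)" for w
  proof -
    define q where "q = engel_denom w"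
    have "1 / real (N + m) \<le> 1 / (real m - 1)"
      using assms(1) by (intro divide_left_mono) auto
    with w have wm: "w \<le> 1 / (real m - 1)" by simp
    have "real (N + m) < 1 / w"
      using w assms(1) by (simp add: field_simps)
    also have "1 / w < real q"
      using engel_denom_bounds(1,2)[OF assms(1) w(1) wm] w(1) assms(1)
      by (simp add: q_def field_simps)
    finally have "N \<le> q - m" by simp
    have "\<bar>\<phi> m w\<bar> \<le> \<bar>r (q - m)\<bar> + \<bar>u (q - m)\<bar> * \<bar>\<phi> q (real q * w - 1)\<bar>"
      unfolding engel_function_step[OF assms(1) w(1) wm, folded q_def] abs_mult[symmetric]
      by (rule abs_triangle_ineq)
    also have "\<dots> \<le> \<bar>r (q - m)\<bar> + \<bar>u (q - m)\<bar> * ?M"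
      by (intro add_left_mono mult_left_mono abs_engel_function_le) auto
    also have "\<dots> \<le> \<epsilon>"
      using N[OF \<open>N \<le> q - m\<close>] by simp
    finally show ?thesis .
  qed
  then show ?thesis
    using assms(1) by (intro exI[of _ "1 / real (N + m)"]) auto
qed

lemma engel_function_diff_on_piece:
  assumes "m \<ge> 2" "m \<le> q"
    and "z \<in> {1 / real q..1 / (real q - 1)}" "w \<in> {1 / real q..1 / (real q - 1)}"
  shows "\<bar>\<phi> m w - \<phi> m z\<bar> \<le> c * \<bar>\<phi> q (real q * w - 1) - \<phi> q (real q * z - 1)\<bar>"
proof -
  have "\<phi> m w - \<phi> m z = u (q - m) * (\<phi> q (real q * w - 1) - \<phi> q (real q * z - 1))"
    using assms by (simp add: engel_function_on_piece right_diff_distrib)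
  then show ?thesis
    using u_le[of "q - m"] by (simp add: abs_mult mult_right_mono)
qed


section \<open>Contraction of the one-sided oscillation\<close>

text \<open>Each passage to the remainder gains a factor \<open>c\<close>, starting from the uniform
  bound. Offset and point vary in the induction; a remainder 0 is settled by
  \<open>engel_function_near_0\<close>.\<close>

lemma engel_function_oscillation_right:
  assumes "m \<ge> 2" "0 \<le> z" "z < 1 / (real m - 1)"
  shows "\<exists>\<delta>>0. \<forall>w. z < w \<and> w < z + \<delta> \<longrightarrow> \<bar>\<phi> m w - \<phi> m z\<bar> \<le> c ^ k * (2 / (1 - c))"
  using assms
proof (induction k arbitrary: m z)
  case 0
  have "\<bar>\<phi> m w - \<phi> m z\<bar> \<le> 2 / (1 - c)" for w
    using abs_engel_function_le[of m w] abs_engel_function_le[of m z] by linarith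
  then show ?case by (intro exI[of _ 1]) simp
next
  case (Suc k)
  show ?case
  proof (cases "z = 0")
    case True
    have "c ^ Suc k * (2 / (1 - c)) > 0" using c by simp
    from engel_function_near_0[OF Suc.prems(1) this] True show ?thesis
      by (simp add: engel_function_def)
  next
    case False
    with Suc.prems have z0: "z > 0" by simp
    \<comment> \<open>here the half-open pieces \<open>[1/q, 1/(q-1))\<close> are needed, so \<open>engel_denom z\<close> is off by one at the end points\<close>
    define q where "q = nat \<lceil>1 / z\<rceil>"
    have "real m - 1 < 1 / z" using Suc.prems z0 by (simp add: field_simps)
    then have mq: "m \<le> q" unfolding q_def by linarith
    have q2: "q \<ge> 2" using mq Suc.prems(1) by simp
    have "1 / z \<le> real q" "real q - 1 < 1 / z"
      using q2 unfolding q_def by linarith+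
    then have b: "1 / real q \<le> z" "z < 1 / (real q - 1)" "real q * z - 1 < z" "0 \<le> real q * z - 1"
      using z0 q2 by (auto simp: field_simps)
    have "real q * z - 1 < 1 / (real q - 1)" using b by simp
    from Suc.IH[OF q2 b(4) this] obtain \<delta> where \<delta>: "\<delta> > 0"
      "\<And>w. real q * z - 1 < w \<Longrightarrow> w < real q * z - 1 + \<delta> \<Longrightarrow>
        \<bar>\<phi> q w - \<phi> q (real q * z - 1)\<bar> \<le> c ^ k * (2 / (1 - c))"
      by blast
    \<comment> \<open>The remainder map stretches distances by \<open>q\<close>; the second entry
      keeps \<open>w\<close> in the piece containing \<open>z\<close>.\<close>
    define \<delta>' where "\<delta>' = min (\<delta> / real q) (1 / (real q - 1) - z)"
    have "\<delta>' > 0" using \<delta>(1) q2 b by (simp add: \<delta>'_def)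
    moreover have "\<bar>\<phi> m w - \<phi> m z\<bar> \<le> c ^ Suc k * (2 / (1 - c))"
      if w: "z < w" "w < z + \<delta>'" for w
    proof -
      have "w < z + \<delta> / real q" "w \<le> 1 / (real q - 1)"
        using w by (auto simp: \<delta>'_def)
      then have "\<bar>\<phi> q (real q * w - 1) - \<phi> q (real q * z - 1)\<bar> \<le> c ^ k * (2 / (1 - c))"
        using w q2 by (intro \<delta>(2)) (auto simp: field_simps)
      then have "c * \<bar>\<phi> q (real q * w - 1) - \<phi> q (real q * z - 1)\<bar> \<le>
          c * (c ^ k * (2 / (1 - c)))"
        using c by (intro mult_left_mono) auto
      moreover have "\<bar>\<phi> m w - \<phi> m z\<bar> \<le>
          c * \<bar>\<phi> q (real q * w - 1) - \<phi> q (real q * z - 1)\<bar>"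
        using w b \<open>w \<le> 1 / (real q - 1)\<close> Suc.prems(1) mq
        by (intro engel_function_diff_on_piece) auto
      ultimately show ?thesis by (simp add: mult.assoc)
    qed
    ultimately show ?thesis by blast
  qed
qed

text \<open>Here the pieces open on the left fit: \<open>z\<close> has room to its left in its
  piece, and the remainder stays positive, so 0 never occurs.\<close>

lemma engel_function_oscillation_left:
  assumes "m \<ge> 2" "0 < z" "z \<le> 1 / (real m - 1)"
  shows "\<exists>\<delta>>0. \<forall>w. z - \<delta> < w \<and> w < z \<longrightarrow> \<bar>\<phi> m w - \<phi> m z\<bar> \<le> c ^ k * (2 / (1 - c))"
  using assms
proof (induction k arbitrary: m z)
  case 0
  have "\<bar>\<phi> m w - \<phi> m z\<bar> \<le> 2 / (1 - c)" for w
    using abs_engel_function_le[of m w] abs_engel_function_le[of m z] by linarith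
  then show ?case by (intro exI[of _ 1]) simp
next
  case (Suc k)
  define q where "q = engel_denom z"
  note b = engel_denom_bounds[OF Suc.prems, folded q_def]
  have q2: "q \<ge> 2" using b(1) Suc.prems(1) by simp
  from Suc.IH[OF q2 b(4,5)] obtain \<delta> where \<delta>: "\<delta> > 0"
    "\<And>w. real q * z - 1 - \<delta> < w \<Longrightarrow> w < real q * z - 1 \<Longrightarrow>
      \<bar>\<phi> q w - \<phi> q (real q * z - 1)\<bar> \<le> c ^ k * (2 / (1 - c))"
    by blast
  define \<delta>' where "\<delta>' = min (\<delta> / real q) (z - 1 / real q)"
  have "\<delta>' > 0" using \<delta>(1) q2 b by (simp add: \<delta>'_def)
  moreover have "\<bar>\<phi> m w - \<phi> m z\<bar> \<le> c ^ Suc k * (2 / (1 - c))"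
    if w: "z - \<delta>' < w" "w < z" for w
  proof -
    have "z - \<delta> / real q < w" "1 / real q \<le> w"
      using w by (auto simp: \<delta>'_def)
    then have "\<bar>\<phi> q (real q * w - 1) - \<phi> q (real q * z - 1)\<bar> \<le> c ^ k * (2 / (1 - c))"
      using w q2 by (intro \<delta>(2)) (auto simp: field_simps)
    then have "c * \<bar>\<phi> q (real q * w - 1) - \<phi> q (real q * z - 1)\<bar> \<le>
        c * (c ^ k * (2 / (1 - c)))"
      using c by (intro mult_left_mono) auto
    moreover have "\<bar>\<phi> m w - \<phi> m z\<bar> \<le>
        c * \<bar>\<phi> q (real q * w - 1) - \<phi> q (real q * z - 1)\<bar>"
      using w b \<open>1 / real q \<le> w\<close> Suc.prems(1)
      by (intro engel_function_diff_on_piece) auto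
    ultimately show ?thesis by (simp add: mult.assoc)
  qed
  ultimately show ?case by blast
qed

section \<open>From oscillation bounds to one-sided continuity\<close>

lemma oscillation_bound_small:
  assumes "\<epsilon> > 0"
  shows "\<exists>k. c ^ k * (2 / (1 - c)) < \<epsilon>"
proof -
  have "0 < \<epsilon> / (2 / (1 - c))" using assms c by simp
  from real_arch_pow_inv[OF this c(2)] show ?thesis
    using c by (simp add: field_simps)
qed

lemma E_function_continuous_right:
  assumes "0 \<le> x" "x < 1"
  shows "continuous (at_right x) (E_function u)"
  unfolding continuous_within tendsto_iff
proof (intro allI impI)
  fix \<epsilon> :: real assume "\<epsilon> > 0"
  then obtain k where k: "c ^ k * (2 / (1 - c)) < \<epsilon>"
    using oscillation_bound_small by blast
  obtain \<delta> where "\<delta> > 0"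
    and \<delta>: "\<And>w. x < w \<Longrightarrow> w < x + \<delta> \<Longrightarrow> \<bar>\<phi> 2 w - \<phi> 2 x\<bar> \<le> c ^ k * (2 / (1 - c))"
    using engel_function_oscillation_right[of 2 x k] assms by auto
  \<comment> \<open>The cap at 1 keeps \<open>w\<close> where \<open>E_function u\<close> agrees
    with \<open>\<phi> 2\<close>.\<close>
  have "dist (E_function u w) (E_function u x) < \<epsilon>" if "x < w" "w < min 1 (x + \<delta>)" for w
    using \<delta>[of w] k that assms by (simp add: E_function_eq dist_real_def)
  moreover have "x < min 1 (x + \<delta>)" using \<open>\<delta> > 0\<close> assms by simp
  ultimately show "\<forall>\<^sub>F w in at_right x. dist (E_function u w) (E_function u x) < \<epsilon>"
    unfolding eventually_at_right_field by blast
qed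

lemma E_function_continuous_left:
  assumes "0 < x" "x \<le> 1"
  shows "continuous (at_left x) (E_function u)"
  unfolding continuous_within tendsto_iff
proof (intro allI impI)
  fix \<epsilon> :: real assume "\<epsilon> > 0"
  then obtain k where k: "c ^ k * (2 / (1 - c)) < \<epsilon>"
    using oscillation_bound_small by blast
  obtain \<delta> where "\<delta> > 0"
    and \<delta>: "\<And>w. x - \<delta> < w \<Longrightarrow> w < x \<Longrightarrow> \<bar>\<phi> 2 w - \<phi> 2 x\<bar> \<le> c ^ k * (2 / (1 - c))"
    using engel_function_oscillation_left[of 2 x k] assms by auto
  have "dist (E_function u w) (E_function u x) < \<epsilon>" if "max 0 (x - \<delta>) < w" "w < x" for w
    using \<delta>[of w] k that assms by (simp add: E_function_eq dist_real_def)
  moreover have "max 0 (x - \<delta>) < x" using \<open>\<delta> > 0\<close> assms by simp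
  ultimately show "\<forall>\<^sub>F w in at_left x. dist (E_function u w) (E_function u x) < \<epsilon>"
    unfolding eventually_at_left_field by blast
qed

end

theorem theorem2:
  fixes u :: "nat \<Rightarrow> real"
  assumes "u sums 1"
    and "\<And>n. \<bar>u n\<bar> < 1"
    and "\<And>n. 0 < tail_sum u n \<and> tail_sum u n < 1"
  shows "(\<forall>x\<in>{0<..<1}. isCont (E_function u) x) \<and>
    continuous (at_right 0) (E_function u) \<and>
    continuous (at_left 1) (E_function u)"
proof -
  obtain c where "0 < c" "c < 1" "\<forall>n. \<bar>u n\<bar> \<le> c"
    using null_sequence_uniform_bound[OF summable_LIMSEQ_zero[OF sums_summable[OF assms(1)]] assms(2)]
    by blast
  then interpret E_weights u c
    using assms by unfold_locales auto
  show ?thesis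
    using E_function_continuous_left E_function_continuous_right
    \<comment> \<open>Interior points have both one-sided limits available; the end points require
      only one.\<close>
    by (simp add: continuous_at_split)
qed

end
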